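(* Let $n \ge 2$ and let subsets $A_i, B_i \subset \mathbb{R}$ be given for $i \in \{1,\dots,n\}$. Then there exists a continuous function $g \colon I^n \to \mathbb{R}$ such that $\mathsf{Conn}_i(g) = A_i$ and $\mathsf{Sep}_i(g) = B_i$ for each $i \in \{1,\dots,n\}$ if and only if the following conditions are all satisfied. (i) Every $A_i$ and every $B_i$ is either a compact interval, a singleton, or the empty set. (ii) For each $i$: if $A_i = \emptyset$, then $B_i$ is a compact interval; if $A_i$ is a singleton, then $A_i = B_i$; and if $A_i$ is a compact interval, then $B_i = \emptyset$. (iii) For each $i$, $B_i \subset \bigcap_{j \ne i} A_j$. (iv) If all $A_i$ are nonempty, then $\bigcap_{i=1}^n A_i$ is nonempty. (v) If $n = 2$, then $A_1 = B_2$ and $A_2 = B_1$.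
   Context: $I^n = [0,1]^n$; for $i \in \{1,\dots,n\}$, $I^n_{i,-} = \{z \in I^n : z_i = 0\}$ and $I^n_{i,+} = \{z \in I^n : z_i = 1\}$. A subset $A \subset I^n$ connects $i$th opposite faces of $I^n$ if there is a connected subset $S \subset A$ with $S \cap I^n_{i,-} \ne \emptyset \ne S \cap I^n_{i,+}$; $A$ separates $i$th opposite faces of $I^n$ if $I^n \setminus A$ does not connect $i$th opposite faces of $I^n$. For a continuous function $g \colon I^n \to \mathbb{R}$, $\mathsf{Conn}_i(g)$ is the set of all $p \in \mathbb{R}$ such that the fiber $g^{-1}[\{p\}]$ connects $i$th opposite faces of $I^n$, and $\mathsf{Sep}_i(g)$ is the set of all $p \in \mathbb{R}$ such that $g^{-1}[\{p\}]$ separates $i$th opposite faces of $I^n$. "Compact interval" means a nondegenerate compact interval $[a,b]$ with $a<b$. *)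

theory Defs
  imports "HOL-Analysis.Analysis"
begin

definition unit_cube :: "(real ^ 'n) set" where
  "unit_cube = cbox 0 1"

lemma mem_unit_cube: "z \<in> unit_cube \<longleftrightarrow> (\<forall>i. 0 \<le> z $ i \<and> z $ i \<le> 1)"
  by (simp add: unit_cube_def mem_box_cart)

definition face_minus :: "'n \<Rightarrow> (real ^ 'n) set" where
  "face_minus i = {z \<in> unit_cube. z $ i = 0}"

definition face_plus :: "'n \<Rightarrow> (real ^ 'n) set" where
  "face_plus i = {z \<in> unit_cube. z $ i = 1}"

(* The next two notions are meant for subsets A of the cube. *)

definition connects_faces :: "'n \<Rightarrow> (real ^ 'n) set \<Rightarrow> bool" where
  "connects_faces i A \<longleftrightarrow>
     (\<exists>S \<subseteq> A. connected S \<and> S \<inter> face_minus i \<noteq> {} \<and> S \<inter> face_plus i \<noteq> {})"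

definition separates_faces :: "'n \<Rightarrow> (real ^ 'n) set \<Rightarrow> bool" where
  "separates_faces i A \<longleftrightarrow> \<not> connects_faces i (unit_cube - A)"

(* A function on the cube is represented by a total function on the whole space;
   only its values on the cube enter the fibers. *)

definition fiber :: "(real ^ 'n \<Rightarrow> real) \<Rightarrow> real \<Rightarrow> (real ^ 'n) set" where
  "fiber g p = {z \<in> unit_cube. g z = p}"

definition Conn :: "'n \<Rightarrow> (real ^ 'n \<Rightarrow> real) \<Rightarrow> real set" where
  "Conn i g = {p. connects_faces i (fiber g p)}"

definition Sep :: "'n \<Rightarrow> (real ^ 'n \<Rightarrow> real) \<Rightarrow> real set" where
  "Sep i g = {p. separates_faces i (fiber g p)}"

definition compact_interval :: "real set \<Rightarrow> bool" where
  "compact_interval X \<longleftrightarrow> (\<exists>a b. a < b \<and> X = {a..b})"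

end

(* Let m_i (M_i) be the threshold such that {g < p} (resp. {g > p}) connects the ith faces iff p > m_i
   (resp. p < M_i). Then Sep_i(g) = [M_i, m_i] and, by unicoherence, Conn_i(g) = [m_i, M_i]. A connected
   set separating the ith faces joins the jth ones, so m_i \<le> M_j for i \<noteq> j; in dimension 2 the
   crossing of paths gives equality. Conditions (i)-(v) say no more than that, and any such thresholds
   are those of a ramp in one coordinate direction, lowered or raised on tubes in the other directions
   (or of a constant, lowered or raised on tubes in all directions). *)

theory Submission
  imports Defs
begin

section \<open>Separation in the cube\<close>

text \<open>The swapped ends of \<open>{m i..M i}\<close> and \<open>{M i..m i}\<close> encode
  condition (ii): \<open>M i < m i\<close>, \<open>m i = M i\<close> and \<open>m i < M i\<close>
  are its three cases. Conditions (iii) and (iv) together amount to \<open>m i \<le> M j\<close> for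
  \<open>i \<noteq> j\<close>. Hence at most one \<open>k\<close> has \<open>M k < m k\<close>,
  since any other \<open>i\<close> satisfies \<open>m i \<le> M k < m k \<le> M i\<close>; this
  \<open>k\<close> is the direction of the ramp. Without such a \<open>k\<close>, a constant
  \<open>c\<close> fits between all \<open>m i\<close> and all \<open>M j\<close>.

  Unicoherence enters in one form only: a closed set that separates opposite faces contains a
  connected set that does so.

  The obstacle in the construction is that a lowering tube and a raising tube must not spoil each
  other. A third coordinate keeps them apart; in dimension 2 they would cross, but there the
  thresholds are so rigid that every tube has height 0.\<close>

lemma unit_cube_basics:
  shows compact_unit_cube: "compact unit_cube"
    and convex_unit_cube: "convex unit_cube"
    and connected_unit_cube: "connected unit_cube"
  by (simp_all add: unit_cube_def convex_connected)

lemma face_subset_unit_cube: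
  shows face_minus_subset: "face_minus i \<subseteq> unit_cube"
    and face_plus_subset: "face_plus i \<subseteq> unit_cube"
  by (auto simp: face_minus_def face_plus_def)

lemma closed_faces:
  shows closed_face_minus: "closed (face_minus i)"
    and closed_face_plus: "closed (face_plus i)"
proof -
  have "face_minus i = unit_cube \<inter> {z. z $ i = 0}" "face_plus i = unit_cube \<inter> {z. z $ i = 1}"
    by (auto simp: face_minus_def face_plus_def)
  then show "closed (face_minus i)" "closed (face_plus i)"
    by (auto intro!: closed_Int compact_imp_closed[OF compact_unit_cube] closed_Collect_eq continuous_intros)
qed

lemma convex_faces:
  shows convex_face_minus: "convex (face_minus i)"
    and convex_face_plus: "convex (face_plus i)"
proof -
  have "face_minus i = unit_cube \<inter> {z. axis i 1 \<bullet> z = 0}" "face_plus i = unit_cube \<inter> {z. axis i 1 \<bullet> z = 1}"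
    by (auto simp: face_minus_def face_plus_def inner_axis')
  then show "convex (face_minus i)" "convex (face_plus i)"
    by (auto intro!: convex_Int convex_unit_cube convex_hyperplane)
qed

lemma connects_faces_mono:
  "connects_faces i A \<Longrightarrow> A \<subseteq> B \<Longrightarrow> connects_faces i B"
  unfolding connects_faces_def by (meson subset_trans)

lemma connects_faces_unit_cube: "connects_faces i unit_cube"
  unfolding connects_faces_def
proof (intro exI conjI)
  have "0 \<in> unit_cube \<inter> face_minus i" "1 \<in> unit_cube \<inter> face_plus i"
    by (auto simp: face_minus_def face_plus_def mem_unit_cube)
  then show "unit_cube \<inter> face_minus i \<noteq> {}" "unit_cube \<inter> face_plus i \<noteq> {}"
    by blast+
qed (auto simp: connected_unit_cube)

lemma adjacent_faces_meet:
  assumes "i \<noteq> j"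
  shows "face_minus j \<inter> face_minus i \<noteq> {}" "face_minus j \<inter> face_plus i \<noteq> {}"
    "face_plus j \<inter> face_minus i \<noteq> {}" "face_plus j \<inter> face_plus i \<noteq> {}"
proof -
  define v :: "real \<Rightarrow> real \<Rightarrow> real^'a" where "v s t = (\<chi> l. if l = i then s else t)" for s t
  have "v 0 0 \<in> face_minus j \<inter> face_minus i" "v 1 0 \<in> face_minus j \<inter> face_plus i"
    "v 0 1 \<in> face_plus j \<inter> face_minus i" "v 1 1 \<in> face_plus j \<inter> face_plus i"
    using assms by (auto simp: v_def face_minus_def face_plus_def mem_unit_cube)
  then show "face_minus j \<inter> face_minus i \<noteq> {}" "face_minus j \<inter> face_plus i \<noteq> {}"
    "face_plus j \<inter> face_minus i \<noteq> {}" "face_plus j \<inter> face_plus i \<noteq> {}"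
    by blast+
qed

definition clamp_cube :: "real ^ 'n \<Rightarrow> real ^ 'n" where
  "clamp_cube x = (\<chi> l. max 0 (min 1 (x $ l)))"

lemma clamp_cube_in: "clamp_cube x \<in> unit_cube"
  by (simp add: clamp_cube_def mem_unit_cube)

lemma clamp_cube_id: "x \<in> unit_cube \<Longrightarrow> clamp_cube x = x"
  by (simp add: clamp_cube_def mem_unit_cube vec_eq_iff)

lemma continuous_clamp_cube: "continuous_on S clamp_cube"
  unfolding clamp_cube_def by (intro continuous_intros)

text \<open>The separation theorem for components of closed sets holds in Euclidean space. It is transferred
  to the cube by extending \<open>K\<close> constantly (along the clamping retraction) in all directions
  except the \<open>i\<close>th one, in which it is cut off at the two faces.\<close>

lemma separates_by_connected:
  fixes K :: "(real ^ 'n) set"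
  assumes K: "closed K" "K \<subseteq> unit_cube" and sep: "separates_faces i K"
  obtains D where "D \<subseteq> K" "connected D" "closed D" "separates_faces i D"
proof -
  define H where "H = clamp_cube -` K \<inter> {x. 0 \<le> x $ i \<and> x $ i \<le> 1}"
  have "closed H"
    unfolding H_def
    by (intro closed_Int closed_vimage K continuous_clamp_cube closed_Collect_conj closed_Collect_le continuous_intros)
  define W where "W = unit_cube - K"
  have lcW: "locally connected W"
    unfolding W_def using K
    by (intro locally_diff_closed convex_imp_locally_connected convex_unit_cube)
      (auto simp: closedin_closed)
  \<comment> \<open>Components of the complement are sorted by whether they reach the lower face;
    since \<open>K\<close> separates, none of those in \<open>U\<close> reaches the upper one. Local
    connectedness makes both unions open.\<close>
  define U where "U = \<Union>{C \<in> components W. C \<inter> face_minus i \<noteq> {}}"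
  define V where "V = \<Union>{C \<in> components W. C \<inter> face_minus i = {}}"
  have "U \<union> V = \<Union>(components W)"
    unfolding U_def V_def by blast
  then have UV: "U \<union> V = W"
    using Union_components[of W] by simp
  have disj: "U \<inter> V = {}"
  proof (rule ccontr)
    assume "U \<inter> V \<noteq> {}"
    then obtain x C C' where "x \<in> C" "x \<in> C'" "C \<in> components W" "C' \<in> components W"
      "C \<inter> face_minus i \<noteq> {}" "C' \<inter> face_minus i = {}"
      unfolding U_def V_def by blast
    then show False using components_nonoverlap[of C W C'] by auto
  qed
  have opW: "openin (top_of_set unit_cube) W"
    unfolding W_def Diff_eq using K(1) by (intro openin_open_Int) (simp add: open_Compl)
  have "openin (top_of_set W) U" "openin (top_of_set W) V"
    unfolding U_def V_def by (intro openin_Union; simp add: openin_components_locally_connected[OF lcW])+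
  then have opUV: "openin (top_of_set unit_cube) U" "openin (top_of_set unit_cube) V"
    using opW openin_trans by blast+
  have Uplus: "U \<inter> face_plus i = {}"
  proof (rule ccontr)
    assume "U \<inter> face_plus i \<noteq> {}"
    then obtain C where "C \<in> components W" "C \<inter> face_minus i \<noteq> {}" "C \<inter> face_plus i \<noteq> {}"
      unfolding U_def by blast
    then have "connects_faces i W"
      unfolding connects_faces_def using in_components_connected in_components_subset by blast
    then show False using sep by (simp add: separates_faces_def W_def)
  qed
  have Vminus: "V \<inter> face_minus i = {}"
    unfolding V_def by blast
  have "clamp_cube \<in> UNIV \<rightarrow> unit_cube"
    by (simp add: Pi_def clamp_cube_in)
  then have open_pre: "open (clamp_cube -` T)" if "openin (top_of_set unit_cube) T" for T :: "(real^'n) set"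
    using continuous_openin_preimage[OF continuous_clamp_cube[of UNIV] _ that] by simp
  \<comment> \<open>Adding the half-spaces beyond the two faces keeps the sets disjoint and makes
    them cover everything outside \<open>H\<close>, so \<open>H\<close> separates \<open>a\<close>
    from \<open>b\<close>.\<close>
  define U' where "U' = {x. x $ i < 0} \<union> clamp_cube -` U"
  define V' where "V' = {x. x $ i > 1} \<union> clamp_cube -` V"
  have op': "open U'" "open V'"
    unfolding U'_def V'_def
    by (simp_all add: open_Un open_pre opUV open_halfspace_component_lt_cart open_halfspace_component_gt_cart)
  have minus: "clamp_cube x \<in> face_minus i" if "x $ i \<le> 0" for x
    using that clamp_cube_in[of x] by (simp add: face_minus_def clamp_cube_def)
  have plus: "clamp_cube x \<in> face_plus i" if "x $ i \<ge> 1" for x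
    using that clamp_cube_in[of x] by (simp add: face_plus_def clamp_cube_def)
  have disj': "U' \<inter> V' = {}"
    using disj minus plus Uplus Vminus by (force simp: U'_def V'_def)
  have cover: "- H \<subseteq> U' \<union> V'"
  proof
    fix x assume "x \<in> - H"
    then consider "x $ i < 0" | "x $ i > 1" | "clamp_cube x \<notin> K"
      by (fastforce simp: H_def)
    then show "x \<in> U' \<union> V'"
    proof cases
      case 3
      then have "clamp_cube x \<in> W" by (simp add: W_def clamp_cube_in)
      then show ?thesis using UV by (auto simp: U'_def V'_def)
    qed (auto simp: U'_def V'_def)
  qed
  define a b :: "real^'n" where "a = (\<chi> l. -1)" and "b = (\<chi> l. 2)"
  have ab: "a \<in> U'" "b \<in> V'"
    by (simp_all add: U'_def V'_def a_def b_def)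
  have "\<not> connected_component (- H) a b"
  proof
    assume "connected_component (- H) a b"
    then obtain T where T: "connected T" "T \<subseteq> - H" "a \<in> T" "b \<in> T"
      by (auto simp: connected_component_def)
    then show False
      using connectedD[OF T(1) op'] disj' cover ab by blast
  qed
  then obtain C where C: "C \<in> components H" "\<not> connected_component (- C) a b"
    using separation_by_component_closed_pointwise[OF \<open>closed H\<close>] by metis
  have CH: "C \<subseteq> H" using C in_components_subset by blast
  \<comment> \<open>\<open>C\<close> may be unbounded, so its clamped image need not be
    closed.\<close>
  define D where "D = closure (clamp_cube ` C)"
  have imK: "clamp_cube ` C \<subseteq> K" using CH by (auto simp: H_def)
  show thesis
  proof (rule that)
    show "D \<subseteq> K" unfolding D_def using imK K(1) by (rule closure_minimal)
    show "connected D"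
      unfolding D_def using C in_components_connected
      by (intro connected_imp_connected_closure connected_continuous_image continuous_clamp_cube) auto
    show "closed D" by (simp add: D_def)
    show "separates_faces i D"
      unfolding separates_faces_def
    proof
      assume "connects_faces i (unit_cube - D)"
      then obtain S s t where S: "S \<subseteq> unit_cube - D" "connected S" "s \<in> S" "s \<in> face_minus i"
        "t \<in> S" "t \<in> face_plus i"
        unfolding connects_faces_def by blast
      have SC: "S \<subseteq> - C"
      proof
        fix x assume "x \<in> S"
        then have "x \<in> unit_cube" "x \<notin> D" using S by auto
        then show "x \<in> - C"
          using clamp_cube_id[of x] closure_subset[of "clamp_cube ` C"] unfolding D_def by force
      qed
      have stx: "s $ i = 0" "t $ i = 1" using S by (auto simp: face_minus_def face_plus_def)
      have st: "connected_component (- C) s t"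
        using S SC by (auto simp: connected_component_def)
      have sx: "s \<notin> C" "t \<notin> C" using S SC by auto
      \<comment> \<open>Past its starting point the segment has negative \<open>i\<close>th
        coordinate, so it has left the slab that contains \<open>C\<close>.\<close>
      have sa: "closed_segment s a \<subseteq> - C"
      proof
        fix x assume "x \<in> closed_segment s a"
        then obtain u where u: "0 \<le> u" "u \<le> 1" "x = (1 - u) *\<^sub>R s + u *\<^sub>R a"
          by (auto simp: in_segment)
        show "x \<in> - C"
        proof (cases "u = 0")
          case False
          then have "x $ i < 0" using u stx by (simp add: a_def)
          then show ?thesis using CH by (auto simp: H_def)
        qed (use u sx in simp)
      qed
      have tb: "closed_segment t b \<subseteq> - C"
      proof
        fix x assume "x \<in> closed_segment t b"
        then obtain u where u: "0 \<le> u" "u \<le> 1" "x = (1 - u) *\<^sub>R t + u *\<^sub>R b"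
          by (auto simp: in_segment)
        show "x \<in> - C"
        proof (cases "u = 0")
          case False
          then have "x $ i > 1" using u stx by (simp add: b_def)
          then show ?thesis using CH by (auto simp: H_def)
        qed (use u sx in simp)
      qed
      have "connected_component (- C) s a" "connected_component (- C) t b"
        using sa tb unfolding connected_component_def
        by (metis connected_segment ends_in_segment)+
      then show False
        using C(2) st by (meson connected_component_sym connected_component_trans)
    qed
  qed
qed

text \<open>By compactness, a set without a connecting connected subset splits into two closed
  pieces, one for each face. A middle level of a Urysohn function between the pieces, each enlarged
  by its face, avoids \<open>C\<close> and separates the faces; it then contains a connected
  separating set.\<close>

lemma separates_disjoint_connected:
  fixes C :: "(real ^ 'n) set"
  assumes C: "compact C" "C \<subseteq> unit_cube" and nc: "\<not> connects_faces i C"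
  obtains D where "D \<subseteq> unit_cube - C" "connected D" "compact D" "separates_faces i D"
proof -
  have "separated_between (top_of_set C) (C \<inter> face_minus i) (C \<inter> face_plus i)"
  proof (rule cut_wire_fence_theorem)
    show "closedin (top_of_set C) (C \<inter> face_minus i)" "closedin (top_of_set C) (C \<inter> face_plus i)"
      using closed_faces[of i] by (auto simp: closedin_closed)
    show "disjnt T (C \<inter> face_minus i) \<or> disjnt T (C \<inter> face_plus i)"
      if "connectedin (top_of_set C) T" for T
      using that nc unfolding connects_faces_def disjnt_def connectedin_subtopology connectedin_iff_connected
      by blast
  qed (use C in \<open>simp_all add: compact_space_subtopology Hausdorff_space_subtopology\<close>)
  then obtain P Q where PQ: "openin (top_of_set C) P" "openin (top_of_set C) Q" "P \<union> Q = C" "disjnt P Q"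
    "C \<inter> face_minus i \<subseteq> P" "C \<inter> face_plus i \<subseteq> Q"
    unfolding separated_between_def by auto
  have "P = C - Q" "Q = C - P" using PQ by (auto simp: disjnt_def)
  then have "closedin (top_of_set C) P" "closedin (top_of_set C) Q"
    using PQ by (metis closedin_diff closedin_topspace topspace_euclidean_subtopology)+
  then have cl: "closed P" "closed Q"
    using C(1) closedin_closed_trans compact_imp_closed by blast+
  have "(P \<union> face_minus i) \<inter> (Q \<union> face_plus i) = {}"
    using PQ by (fastforce simp: disjnt_def face_minus_def face_plus_def)
  then obtain h :: "real^'n \<Rightarrow> real" where h: "continuous_on UNIV h"
    "\<And>x. x \<in> P \<union> face_minus i \<Longrightarrow> h x = 0" "\<And>x. x \<in> Q \<union> face_plus i \<Longrightarrow> h x = 1"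
    using Urysohn[of "P \<union> face_minus i" "Q \<union> face_plus i" 0 1] closed_faces cl by (metis closed_Un)
  define K where "K = unit_cube \<inter> {x. h x = 1/2}"
  have Kcl: "closed K"
    unfolding K_def
    by (intro closed_Int compact_imp_closed[OF compact_unit_cube] closed_Collect_eq h(1) continuous_intros)
  have "separates_faces i K"
    unfolding separates_faces_def
  proof
    assume "connects_faces i (unit_cube - K)"
    then obtain S s t where S: "S \<subseteq> unit_cube - K" "connected S" "s \<in> S" "s \<in> face_minus i"
      "t \<in> S" "t \<in> face_plus i"
      unfolding connects_faces_def by blast
    have "connected (h ` S)"
      using S(2) h(1) connected_continuous_image continuous_on_subset by blast
    moreover have "h s = 0" "h t = 1" using h(2,3) S by auto
    ultimately have "1/2 \<in> h ` S"
      using connectedD_interval[of "h ` S" "h s" "h t" "1/2"] S(3,5) by simp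
    then show False using S(1) by (auto simp: K_def)
  qed
  then obtain D where D: "D \<subseteq> K" "connected D" "closed D" "separates_faces i D"
    using separates_by_connected[OF Kcl] by (auto simp: K_def)
  show thesis
  proof (rule that)
    have "K \<inter> C = {}"
      using h(2,3) PQ(3) by (fastforce simp: K_def)
    then show "D \<subseteq> unit_cube - C" using D(1) by (auto simp: K_def)
    then show "compact D"
      using D(3) compact_unit_cube compact_Int_closed[of unit_cube D] by (simp add: Int_absorb1 subset_eq)
  qed (use D in auto)
qed

text \<open>Relatively open subsets of the cube are locally path connected. The path supplies a
  compact connecting set, on which extrema are attained, and an input for the crossing
  theorem.\<close>

lemma connects_faces_path:
  fixes G :: "(real ^ 'n) set"
  assumes "openin (top_of_set unit_cube) G" "connects_faces i G"
  obtains \<gamma> where "path \<gamma>" "path_image \<gamma> \<subseteq> G" "pathstart \<gamma> \<in> face_minus i" "pathfinish \<gamma> \<in> face_plus i"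
proof -
  obtain S s t where "S \<subseteq> G" "connected S" "s \<in> S" "s \<in> face_minus i" "t \<in> S" "t \<in> face_plus i"
    using assms(2) unfolding connects_faces_def by blast
  moreover from this have "connected_component G s t"
    by (auto simp: connected_component_def)
  moreover have "locally path_connected G"
    using assms(1) convex_imp_locally_path_connected[OF convex_unit_cube] locally_open_subset by blast
  ultimately show thesis
    using that by (metis path_component_def path_component_eq_connected_component)
qed

section \<open>Thresholds of sublevel and superlevel sets\<close>

text \<open>Strictness matters: \<open>{g < m}\<close> itself does not connect the faces, which is
  why \<open>Sep\<close> contains its endpoint \<open>m\<close>.\<close>

definition sublevel_threshold :: "'n \<Rightarrow> (real ^ 'n \<Rightarrow> real) \<Rightarrow> real \<Rightarrow> bool" where
  "sublevel_threshold i g m \<longleftrightarrow> (\<forall>p. connects_faces i {z \<in> unit_cube. g z < p} \<longleftrightarrow> m < p)"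

definition superlevel_threshold :: "'n \<Rightarrow> (real ^ 'n \<Rightarrow> real) \<Rightarrow> real \<Rightarrow> bool" where
  "superlevel_threshold i g M \<longleftrightarrow> (\<forall>p. connects_faces i {z \<in> unit_cube. p < g z} \<longleftrightarrow> p < M)"

lemma superlevel_threshold_uminus:
  "superlevel_threshold i g M \<longleftrightarrow> sublevel_threshold i (\<lambda>z. - g z) (- M)"
  unfolding superlevel_threshold_def sublevel_threshold_def
  by (metis (no_types, lifting) Collect_cong minus_minus neg_less_iff_less)

lemma openin_levels:
  assumes "continuous_on unit_cube g"
  shows openin_sublevel: "openin (top_of_set unit_cube) {z \<in> unit_cube. g z < (p::real)}"
    and openin_superlevel: "openin (top_of_set unit_cube) {z \<in> unit_cube. p < g z}"
  using continuous_openin_preimage_gen[OF assms open_lessThan[of p]]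
    continuous_openin_preimage_gen[OF assms open_greaterThan[of p]]
  by (simp_all add: vimage_def Int_def)

text \<open>The threshold is the infimum of the connecting levels. It is not attained: on a compact
  connecting path inside \<open>{g < p}\<close> the maximum of \<open>g\<close> is below
  \<open>p\<close>, so a smaller level still connects.\<close>

lemma sublevel_threshold_exists:
  fixes g :: "real ^ 'n \<Rightarrow> real"
  assumes g: "continuous_on unit_cube g"
  obtains m where "sublevel_threshold i g m"
proof -
  define P where "P p \<longleftrightarrow> connects_faces i {z \<in> unit_cube. g z < p}" for p
  have mono: "P q" if "P p" "p \<le> q" for p q
    using that(2) by (auto simp: P_def intro: connects_faces_mono[OF that(1)[unfolded P_def]])
  have opn: "\<exists>q<p. P q" if Pp: "P p" for p
  proof -
    obtain \<gamma> where \<gamma>: "path \<gamma>" "path_image \<gamma> \<subseteq> {z \<in> unit_cube. g z < p}"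
      "pathstart \<gamma> \<in> face_minus i" "pathfinish \<gamma> \<in> face_plus i"
      by (rule connects_faces_path[OF openin_sublevel[OF g] Pp[unfolded P_def]])
    have "continuous_on (path_image \<gamma>) g"
      using g \<gamma>(2) by (auto intro: continuous_on_subset)
    then obtain x where x: "x \<in> path_image \<gamma>" "\<And>y. y \<in> path_image \<gamma> \<Longrightarrow> g y \<le> g x"
      using continuous_attains_sup[OF compact_path_image[OF \<gamma>(1)], of g] by auto
    obtain q where q: "g x < q" "q < p"
      using x(1) \<gamma>(2) dense[of "g x" p] by auto
    have "P q"
      unfolding P_def connects_faces_def
    proof (intro exI conjI)
      show "path_image \<gamma> \<subseteq> {z \<in> unit_cube. g z < q}"
        using \<gamma>(2) x(2) q(1) by force
      show "connected (path_image \<gamma>)" using \<gamma>(1) by (rule connected_path_image)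
      show "path_image \<gamma> \<inter> face_minus i \<noteq> {}" "path_image \<gamma> \<inter> face_plus i \<noteq> {}"
        using \<gamma>(3,4) pathstart_in_path_image pathfinish_in_path_image by blast+
    qed
    then show ?thesis using q(2) by blast
  qed
  have "bounded (g ` unit_cube)"
    using compact_continuous_image[OF g compact_unit_cube] compact_imp_bounded by blast
  then obtain B where B: "\<And>z. z \<in> unit_cube \<Longrightarrow> \<bar>g z\<bar> \<le> B"
    by (auto simp: bounded_iff)
  have "{z \<in> unit_cube. g z < B + 1} = unit_cube"
    using B by force
  then have ne: "P (B + 1)"
    by (simp add: P_def connects_faces_unit_cube)
  have lb: "- B \<le> p" if "P p" for p
  proof (rule ccontr)
    assume "\<not> - B \<le> p"
    then have "{z \<in> unit_cube. g z < p} = {}"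
      using B by force
    from that[unfolded P_def this] show False by (simp add: connects_faces_def)
  qed
  have bdd: "bdd_below (Collect P)" using lb unfolding bdd_below_def by blast
  have "P p \<longleftrightarrow> Inf (Collect P) < p" for p
  proof
    assume "P p"
    then obtain q where "q < p" "P q" using opn by blast
    then show "Inf (Collect P) < p" using cInf_lower[OF _ bdd, of q] by auto
  next
    assume "Inf (Collect P) < p"
    then obtain q where "P q" "q < p"
      using cInf_less_iff[OF _ bdd, of p] ne by auto
    then show "P p" using mono by force
  qed
  then show thesis using that by (auto simp: sublevel_threshold_def P_def)
qed

lemma superlevel_threshold_exists:
  fixes g :: "real ^ 'n \<Rightarrow> real"
  assumes g: "continuous_on unit_cube g"
  obtains M where "superlevel_threshold i g M"
  using sublevel_threshold_exists[OF continuous_on_minus[OF g], of i] that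
  by (metis superlevel_threshold_uminus minus_minus)

section \<open>Intervals of connecting and separating levels\<close>

lemma connected_real_avoids:
  fixes X :: "real set"
  assumes "connected X" "p \<notin> X"
  shows "X \<subseteq> {..<p} \<or> X \<subseteq> {p<..}"
proof (rule ccontr)
  assume "\<not> ?thesis"
  then obtain x y where "x \<in> X" "y \<in> X" "\<not> x < p" "\<not> p < y"
    by blast
  then show False
    using connectedD_interval[OF assms(1), of y x p] assms(2) by simp
qed

lemma Sep_eq_thresholds:
  fixes g :: "real ^ 'n \<Rightarrow> real"
  assumes g: "continuous_on unit_cube g" and m: "sublevel_threshold i g m" and M: "superlevel_threshold i g M"
  shows "Sep i g = {M..m}"
proof -
  have "connects_faces i (unit_cube - fiber g p) \<longleftrightarrow> m < p \<or> p < M" for p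
  proof
    assume "connects_faces i (unit_cube - fiber g p)"
    then obtain S where S: "S \<subseteq> unit_cube - fiber g p" "connected S" "S \<inter> face_minus i \<noteq> {}" "S \<inter> face_plus i \<noteq> {}"
      by (auto simp: connects_faces_def)
    have "connected (g ` S)"
      using S(1,2) g by (intro connected_continuous_image) (auto intro: continuous_on_subset)
    moreover have "p \<notin> g ` S"
      using S(1) by (auto simp: fiber_def)
    ultimately have "g ` S \<subseteq> {..<p} \<or> g ` S \<subseteq> {p<..}"
      by (rule connected_real_avoids)
    then have "S \<subseteq> {z \<in> unit_cube. g z < p} \<or> S \<subseteq> {z \<in> unit_cube. p < g z}"
      using S(1) by auto
    then have "connects_faces i {z \<in> unit_cube. g z < p} \<or> connects_faces i {z \<in> unit_cube. p < g z}"
      using S unfolding connects_faces_def by blast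
    then show "m < p \<or> p < M"
      using m M by (auto simp: sublevel_threshold_def superlevel_threshold_def)
  next
    assume "m < p \<or> p < M"
    then have "connects_faces i {z \<in> unit_cube. g z < p} \<or> connects_faces i {z \<in> unit_cube. p < g z}"
      using m M by (auto simp: sublevel_threshold_def superlevel_threshold_def)
    then show "connects_faces i (unit_cube - fiber g p)"
      by (auto elim: connects_faces_mono simp: fiber_def)
  qed
  then show ?thesis
    by (auto simp: Sep_def separates_faces_def not_less)
qed

text \<open>Suppose \<open>m \<le> p \<le> M\<close> and the fiber does not connect. Some compact
  connected separating \<open>D\<close> misses it, so \<open>g\<close> stays on one side of
  \<open>p\<close> on \<open>D\<close>, say below. The maximum of \<open>g\<close> on
  \<open>D\<close> is then less than \<open>M\<close>, so the points with larger values connect the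
  faces while avoiding \<open>D\<close>, a contradiction.\<close>

lemma Conn_eq_thresholds:
  fixes g :: "real ^ 'n \<Rightarrow> real"
  assumes g: "continuous_on unit_cube g" and m: "sublevel_threshold i g m" and M: "superlevel_threshold i g M"
  shows "Conn i g = {m..M}"
proof (intro set_eqI iffI)
  fix p assume "p \<in> Conn i g"
  then have C: "connects_faces i (fiber g p)" by (simp add: Conn_def)
  have "connects_faces i {z \<in> unit_cube. g z < q}" if "p < q" for q
    using that by (intro connects_faces_mono[OF C]) (auto simp: fiber_def)
  moreover have "connects_faces i {z \<in> unit_cube. q < g z}" if "q < p" for q
    using that by (intro connects_faces_mono[OF C]) (auto simp: fiber_def)
  ultimately have "\<forall>q>p. m < q" "\<forall>q<p. q < M"
    using m M by (auto simp: sublevel_threshold_def superlevel_threshold_def)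
  then show "p \<in> {m..M}"
    by (metis atLeastAtMost_iff dense_ge dense_le less_imp_le)
next
  fix p assume p: "p \<in> {m..M}"
  show "p \<in> Conn i g"
  proof (rule ccontr)
    assume "p \<notin> Conn i g"
    moreover have "fiber g p = unit_cube \<inter> g -` {p}"
      by (auto simp: fiber_def)
    then have "compact (fiber g p)"
      using continuous_closed_preimage[OF g compact_imp_closed[OF compact_unit_cube], of "{p}"]
        compact_Int_closed[OF compact_unit_cube, of "fiber g p"] by (simp add: Int_absorb1)
    ultimately obtain D where D: "D \<subseteq> unit_cube - fiber g p" "connected D" "compact D" "separates_faces i D"
      using separates_disjoint_connected[of "fiber g p" i] by (auto simp: Conn_def fiber_def)
    have gD: "continuous_on D g"
      using D(1) g by (auto intro: continuous_on_subset)
    have "D \<noteq> {}"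
      using D(4) connects_faces_unit_cube[of i] by (auto simp: separates_faces_def)
    have "connected (g ` D)"
      using gD D(2) by (rule connected_continuous_image)
    moreover have "p \<notin> g ` D"
      using D(1) by (auto simp: fiber_def)
    ultimately have "g ` D \<subseteq> {..<p} \<or> g ` D \<subseteq> {p<..}"
      by (rule connected_real_avoids)
    then consider "g ` D \<subseteq> {..<p}" | "g ` D \<subseteq> {p<..}"
      by blast
    then show False
    proof cases
      case 1
      obtain x where "x \<in> D" "\<And>y. y \<in> D \<Longrightarrow> g y \<le> g x"
        using continuous_attains_sup[OF D(3) \<open>D \<noteq> {}\<close> gD] by auto
      moreover have "connects_faces i {z \<in> unit_cube. g x < g z}"
        using 1 \<open>x \<in> D\<close> p M by (auto simp: superlevel_threshold_def)
      ultimately have "connects_faces i (unit_cube - D)"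
        by (elim connects_faces_mono) (force simp: not_less)
      then show False using D(4) by (simp add: separates_faces_def)
    next
      case 2
      obtain x where "x \<in> D" "\<And>y. y \<in> D \<Longrightarrow> g x \<le> g y"
        using continuous_attains_inf[OF D(3) \<open>D \<noteq> {}\<close> gD] by auto
      moreover have "connects_faces i {z \<in> unit_cube. g z < g x}"
        using 2 \<open>x \<in> D\<close> p m by (auto simp: sublevel_threshold_def)
      ultimately have "connects_faces i (unit_cube - D)"
        by (elim connects_faces_mono) (force simp: not_less)
      then show False using D(4) by (simp add: separates_faces_def)
    qed
  qed
qed

text \<open>A connected set separating the \<open>i\<close>th faces must hit both \<open>j\<close>th faces, since each of these
  joins the \<open>i\<close>th faces.\<close>

lemma thresholds_le:
  fixes g :: "real ^ 'n \<Rightarrow> real"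
  assumes g: "continuous_on unit_cube g" and m: "sublevel_threshold i g m" and M: "superlevel_threshold j g M"
    and "i \<noteq> j"
  shows "m \<le> M"
proof -
  \<comment> \<open>The complement \<open>{g < m}\<close> does not connect the \<open>i\<close>th
    faces, because the threshold is strict.\<close>
  define K where "K = unit_cube \<inter> g -` {m..}"
  have "closed K"
    unfolding K_def by (intro continuous_closed_preimage[OF g compact_imp_closed[OF compact_unit_cube]]) simp
  moreover have "unit_cube - K = {z \<in> unit_cube. g z < m}"
    by (auto simp: K_def)
  then have "separates_faces i K"
    using m by (simp add: separates_faces_def sublevel_threshold_def)
  moreover have "K \<subseteq> unit_cube"
    by (auto simp: K_def)
  ultimately obtain D where D: "D \<subseteq> K" "connected D" "separates_faces i D"
    using separates_by_connected by metis
  have "D \<inter> F \<noteq> {}" if "F = face_minus j \<or> F = face_plus j" for F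
  proof
    assume "D \<inter> F = {}"
    then have "F \<subseteq> unit_cube - D"
      using that face_subset_unit_cube by blast
    moreover have "connected F"
      using that convex_faces convex_connected by blast
    moreover have "F \<inter> face_minus i \<noteq> {}" "F \<inter> face_plus i \<noteq> {}"
      using that adjacent_faces_meet[OF \<open>i \<noteq> j\<close>] by auto
    ultimately have "connects_faces i (unit_cube - D)"
      unfolding connects_faces_def by blast
    then show False using D(3) by (simp add: separates_faces_def)
  qed
  then have "D \<inter> face_minus j \<noteq> {}" "D \<inter> face_plus j \<noteq> {}"
    by simp_all
  then have CK: "connects_faces j K"
    unfolding connects_faces_def using D(1,2) by blast
  have "connects_faces j {z \<in> unit_cube. q < g z}" if "q < m" for q
    using that by (intro connects_faces_mono[OF CK]) (auto simp: K_def)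
  then have "q < M" if "q < m" for q
    using that M by (simp add: superlevel_threshold_def)
  then show ?thesis
    by (meson dense_le less_imp_le)
qed

lemma planar_paths_meet:
  fixes f g :: "real \<Rightarrow> real ^ 'n"
  assumes card: "CARD('n) = 2" and "i \<noteq> j"
    and f: "path f" "path_image f \<subseteq> unit_cube" "pathstart f \<in> face_minus i" "pathfinish f \<in> face_plus i"
    and g: "path g" "path_image g \<subseteq> unit_cube" "pathstart g \<in> face_minus j" "pathfinish g \<in> face_plus j"
  shows "path_image f \<inter> path_image g \<noteq> {}"
proof -
  have UN: "UNIV = {i, j}"
    using card \<open>i \<noteq> j\<close> by (intro card_subset_eq[symmetric]) auto
  \<comment> \<open>The index type is an arbitrary one with two elements; \<open>\<phi>\<close>
    carries the paths to \<open>real^2\<close>, where \<open>fashoda\<close> applies.\<close>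
  define \<phi> :: "real^'n \<Rightarrow> real^2" where "\<phi> z = (\<chi> l. if l = 1 then z $ i else z $ j)" for z
  have cont: "continuous_on S \<phi>" for S
    unfolding \<phi>_def
  proof (intro continuous_intros)
    show "continuous_on S (\<lambda>z. if l = 1 then z $ i else z $ j)" for l :: 2
      by (cases "l = 1") (auto intro: continuous_intros)
  qed
  have inj: "x = y" if "\<phi> x = \<phi> y" for x y
  proof -
    have "x $ i = y $ i" "x $ j = y $ j"
      using that by (auto simp: \<phi>_def vec_eq_iff forall_2)
    then show ?thesis
      unfolding vec_eq_iff using UN by (metis UNIV_I insertE singletonD)
  qed
  obtain z where "z \<in> path_image (\<phi> \<circ> f)" "z \<in> path_image (\<phi> \<circ> g)"
  proof (rule fashoda[of "\<phi> \<circ> f" "\<phi> \<circ> g" 0 1])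
    show "path (\<phi> \<circ> f)" "path (\<phi> \<circ> g)"
      using f(1) g(1) by (simp_all add: path_continuous_image cont)
    show "path_image (\<phi> \<circ> f) \<subseteq> cbox 0 1" "path_image (\<phi> \<circ> g) \<subseteq> cbox 0 1"
      using f(2) g(2) by (auto simp: path_image_compose mem_box_cart forall_2 \<phi>_def mem_unit_cube)
  qed (use f g in \<open>simp_all add: \<phi>_def face_minus_def face_plus_def pathstart_compose pathfinish_compose\<close>)
  then show ?thesis
    using inj by (fastforce simp: path_image_compose)
qed

text \<open>For a level strictly between \<open>m\<close> and \<open>M\<close>, a path below it
  joining the \<open>i\<close>th faces would have to cross a path above it joining the
  \<open>j\<close>th faces.\<close>

lemma thresholds_ge_planar:
  fixes g :: "real ^ 'n \<Rightarrow> real"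
  assumes card: "CARD('n) = 2"
    and g: "continuous_on unit_cube g" and m: "sublevel_threshold i g m" and M: "superlevel_threshold j g M"
    and "i \<noteq> j"
  shows "M \<le> m"
proof (rule ccontr)
  assume "\<not> M \<le> m"
  then obtain p where p: "m < p" "p < M"
    using dense by (metis not_le)
  have "connects_faces i {z \<in> unit_cube. g z < p}" "connects_faces j {z \<in> unit_cube. p < g z}"
    using p m M by (auto simp: sublevel_threshold_def superlevel_threshold_def)
  note c = connects_faces_path[OF openin_sublevel[OF g] this(1)]
    connects_faces_path[OF openin_superlevel[OF g] this(2)]
  obtain f where f: "path f" "path_image f \<subseteq> {z \<in> unit_cube. g z < p}"
    "pathstart f \<in> face_minus i" "pathfinish f \<in> face_plus i"
    by (rule c(1))
  obtain h where h: "path h" "path_image h \<subseteq> {z \<in> unit_cube. p < g z}"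
    "pathstart h \<in> face_minus j" "pathfinish h \<in> face_plus j"
    by (rule c(2))
  have "path_image f \<inter> path_image h \<noteq> {}"
    using f h by (intro planar_paths_meet[OF card \<open>i \<noteq> j\<close>]) auto
  then show False
    using f(2) h(2) by force
qed

section \<open>Functions with prescribed thresholds\<close>

lemma connects_faces_line:
  fixes A :: "(real ^ 'n) set"
  assumes c: "0 \<le> c" "c \<le> 1"
    and A: "\<And>t. 0 \<le> t \<Longrightarrow> t \<le> 1 \<Longrightarrow> (\<chi> l. if l = i then t else c) \<in> A"
  shows "connects_faces i A"
proof -
  define v :: "real \<Rightarrow> real ^ 'n" where "v t = (\<chi> l. if l = i then t else c)" for t
  have "continuous_on {0..1} v"
    unfolding v_def
  proof (intro continuous_intros)
    show "continuous_on {0..1} (\<lambda>t. if l = i then t else c)" for l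
      by (cases "l = i") auto
  qed
  then have "connected (v ` {0..1})"
    by (intro connected_continuous_image) auto
  moreover have "v ` {0..1} \<subseteq> A"
    using A by (auto simp: v_def)
  moreover have "v 0 \<in> face_minus i" "v 1 \<in> face_plus i"
    using c by (auto simp: v_def face_minus_def face_plus_def mem_unit_cube)
  moreover have "v 0 \<in> v ` {0..1}" "v 1 \<in> v ` {0..1}"
    by simp_all
  ultimately show ?thesis
    unfolding connects_faces_def by blast
qed

text \<open>The line connects every sublevel set above \<open>m\<close>. A bound on just one of the
  two faces blocks the others, since a connecting set meets both.\<close>

lemma sublevel_thresholdI:
  fixes g :: "real ^ 'n \<Rightarrow> real"
  assumes "0 \<le> c" "c \<le> 1"
    and line: "\<And>t. 0 \<le> t \<Longrightarrow> t \<le> 1 \<Longrightarrow> g (\<chi> l. if l = i then t else c) \<le> m"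
    and face: "(\<forall>z\<in>face_minus i. m \<le> g z) \<or> (\<forall>z\<in>face_plus i. m \<le> g z)"
  shows "sublevel_threshold i g m"
  unfolding sublevel_threshold_def
proof (intro allI iffI)
  fix p assume "m < p"
  show "connects_faces i {z \<in> unit_cube. g z < p}"
  proof (rule connects_faces_line[OF assms(1,2)])
    fix t :: real assume t: "0 \<le> t" "t \<le> 1"
    show "(\<chi> l. if l = i then t else c) \<in> {z \<in> unit_cube. g z < p}"
      using line[OF t] t assms(1,2) \<open>m < p\<close> by (simp add: mem_unit_cube)
  qed
next
  fix p assume "connects_faces i {z \<in> unit_cube. g z < p}"
  then obtain x y where "x \<in> face_minus i" "g x < p" "y \<in> face_plus i" "g y < p"
    unfolding connects_faces_def by blast
  then show "m < p"
    using face by (auto intro: le_less_trans)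
qed

lemma superlevel_thresholdI:
  fixes g :: "real ^ 'n \<Rightarrow> real"
  assumes "0 \<le> c" "c \<le> 1"
    and "\<And>t. 0 \<le> t \<Longrightarrow> t \<le> 1 \<Longrightarrow> M \<le> g (\<chi> l. if l = i then t else c)"
    and "(\<forall>z\<in>face_minus i. g z \<le> M) \<or> (\<forall>z\<in>face_plus i. g z \<le> M)"
  shows "superlevel_threshold i g M"
  unfolding superlevel_threshold_uminus
  by (rule sublevel_thresholdI[OF assms(1,2)]) (use assms(3,4) in auto)

text \<open>The zeros at 0 and 1 keep tubes off the faces of other directions; the zero at 3/4 keeps
  the lowering tubes off the raising lines, and by reflection conversely.\<close>

definition tent :: "real \<Rightarrow> real" where
  "tent t = max 0 (1 - 4 * \<bar>t - 1/4\<bar>)"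

lemma tent_simps [simp]:
  "tent 0 = 0" "tent 1 = 0" "tent (1/4) = 1" "tent (3/4) = 0"
  by (simp_all add: tent_def)

lemma tent_bounds: "0 \<le> tent t" "tent t \<le> 1"
  by (simp_all add: tent_def)

definition tube :: "'n \<Rightarrow> real ^ 'n \<Rightarrow> real" where
  "tube i x = (\<Prod>l\<in>-{i}. tent (x $ l))"

lemma tube_bounds: "0 \<le> tube i x" "tube i x \<le> 1"
  unfolding tube_def using tent_bounds by (auto intro: prod_nonneg prod_le_1)

lemma tube_eq_0: "l \<noteq> i \<Longrightarrow> tent (x $ l) = 0 \<Longrightarrow> tube i x = 0"
  unfolding tube_def by (rule prod_zero) auto

lemma continuous_tube: "continuous_on S f \<Longrightarrow> continuous_on S (\<lambda>x. tube i (f x))"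
  unfolding tube_def tent_def by (intro continuous_intros)

lemma sum_tubes_bounds:
  fixes \<alpha> :: "'n::finite \<Rightarrow> real"
  assumes "\<And>j. 0 \<le> \<alpha> j"
  shows sum_tubes_nonneg: "0 \<le> (\<Sum>j\<in>UNIV. \<alpha> j * tube j x)"
    and sum_tubes_ge: "\<alpha> i * tube i x \<le> (\<Sum>j\<in>UNIV. \<alpha> j * tube j x)"
    and sum_tubes_face: "x $ i = 0 \<or> x $ i = 1 \<Longrightarrow> (\<Sum>j\<in>UNIV. \<alpha> j * tube j x) \<le> \<alpha> i"
proof -
  have nn: "0 \<le> \<alpha> j * tube j x" for j
    by (intro mult_nonneg_nonneg assms tube_bounds)
  show "0 \<le> (\<Sum>j\<in>UNIV. \<alpha> j * tube j x)"
    using nn by (simp add: sum_nonneg)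
  show "\<alpha> i * tube i x \<le> (\<Sum>j\<in>UNIV. \<alpha> j * tube j x)"
    by (rule member_le_sum) (use nn in auto)
  assume "x $ i = 0 \<or> x $ i = 1"
  then have "tube j x = 0" if "j \<noteq> i" for j
    using that tube_eq_0[of i j x] by auto
  then have "(\<Sum>j\<in>UNIV. \<alpha> j * tube j x) = (\<Sum>j\<in>{i}. \<alpha> j * tube j x)"
    by (intro sum.mono_neutral_right) auto
  also have "\<dots> \<le> \<alpha> i"
    using mult_left_le[OF tube_bounds(2) assms] by simp
  finally show "(\<Sum>j\<in>UNIV. \<alpha> j * tube j x) \<le> \<alpha> i" .
qed

text \<open>A ramp from \<open>L\<close> to \<open>U\<close> in the \<open>k\<close>th direction, lowered by \<open>\<alpha> i\<close> on a tube around the line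
  in direction \<open>i\<close> all of whose other coordinates are \<open>1/4\<close>, and raised by \<open>\<beta> i\<close> on the
  corresponding tube for \<open>3/4\<close>. The \<open>i\<close>th faces meet no tube other than the two in direction \<open>i\<close>.
  In dimension at least 3, each of the lines avoids all tubes of the other kind.\<close>

definition ramp_tubes :: "'n \<Rightarrow> real \<Rightarrow> real \<Rightarrow> ('n \<Rightarrow> real) \<Rightarrow> ('n \<Rightarrow> real) \<Rightarrow> real ^ 'n \<Rightarrow> real" where
  "ramp_tubes k L U \<alpha> \<beta> x = L + (U - L) * max 0 (min 1 (2 * x $ k - 1/2))
     - (\<Sum>j\<in>UNIV. \<alpha> j * tube j x) + (\<Sum>j\<in>UNIV. \<beta> j * tube j (1 - x))"

lemma continuous_ramp_tubes: "continuous_on S (ramp_tubes k L U \<alpha> \<beta>)"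
  unfolding ramp_tubes_def by (intro continuous_intros continuous_tube)

text \<open>\<open>avoid\<close> provides, for each tube of nonzero height and each line, a
  coordinate in which they are apart. \<open>zero\<close> forbids tubes along a genuine ramp, so
  that its two end faces keep the values that determine the thresholds in direction
  \<open>k\<close>.\<close>

lemma ramp_tubes_thresholds:
  fixes k :: "'n::finite" and \<alpha> \<beta> :: "'n \<Rightarrow> real"
  assumes LU: "L \<le> U" and nn: "\<And>j. 0 \<le> \<alpha> j" "\<And>j. 0 \<le> \<beta> j"
    and zero: "L < U \<Longrightarrow> \<alpha> k = 0 \<and> \<beta> k = 0"
    and avoid: "\<And>i j. \<alpha> j \<noteq> 0 \<or> \<beta> j \<noteq> 0 \<Longrightarrow> \<exists>l. l \<noteq> i \<and> l \<noteq> j"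
  defines "g \<equiv> ramp_tubes k L U \<alpha> \<beta>"
  shows "i \<noteq> k \<or> L = U \<Longrightarrow> sublevel_threshold i g (L - \<alpha> i)"
    and "i \<noteq> k \<or> L = U \<Longrightarrow> superlevel_threshold i g (U + \<beta> i)"
    and "L < U \<Longrightarrow> sublevel_threshold k g U"
    and "L < U \<Longrightarrow> superlevel_threshold k g L"
proof -
  \<comment> \<open>The factor is 0 for \<open>x $ k \<le> 1/4\<close> and 1 for
    \<open>x $ k \<ge> 3/4\<close>, so lines in directions other than \<open>k\<close> run entirely
    at height \<open>L\<close> or \<open>U\<close>.\<close>
  define f where "f x = L + (U - L) * max 0 (min 1 (2 * x $ k - 1/2))" for x :: "real^'n"
  define a where "a x = (\<Sum>j\<in>UNIV. \<alpha> j * tube j x)" for x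
  define b where "b x = (\<Sum>j\<in>UNIV. \<beta> j * tube j (1 - x))" for x
  have g: "g x = f x - a x + b x" for x
    by (simp add: g_def ramp_tubes_def f_def a_def b_def)
  have f: "L \<le> f x" "f x \<le> U" for x
    using LU mult_left_le[of "max 0 (min 1 (2 * x $ k - 1/2))" "U - L"] by (auto simp: f_def)
  have ab: "0 \<le> a x" "0 \<le> b x" for x
    unfolding a_def b_def using nn by (auto intro: sum_tubes_nonneg)
  have face: "a x \<le> \<alpha> i" "b x \<le> \<beta> i" if "x $ i = 0 \<or> x $ i = 1" for x i
    unfolding a_def b_def using nn that by (auto intro!: sum_tubes_face)
  define v :: "'n \<Rightarrow> real \<Rightarrow> real \<Rightarrow> real ^ 'n" where "v i c t = (\<chi> l. if l = i then t else c)" for i c t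
  have compl: "1 - v i c t = v i (1 - c) (1 - t)" for i c t
    by (simp add: v_def vec_eq_iff)
  have tube1: "tube i (v i (1/4) t) = 1" for i t
    by (simp add: tube_def v_def)
  have tube0: "tube j (v i (3/4) t) = 0" if j: "\<alpha> j \<noteq> 0 \<or> \<beta> j \<noteq> 0" for i j t
  proof -
    obtain l where "l \<noteq> i" "l \<noteq> j" using avoid[OF j] by blast
    then show ?thesis by (intro tube_eq_0[of l]) (auto simp: v_def)
  qed
  \<comment> \<open>An inequality is enough: other lowering tubes may cross this line, and lowering
    \<open>g\<close> further there is harmless.\<close>
  have a1: "\<alpha> i \<le> a (v i (1/4) t)" for i t
    using sum_tubes_ge[where \<alpha>=\<alpha> and x="v i (1/4) t" and i=i] nn by (simp add: a_def tube1)
  have b1: "\<beta> i \<le> b (v i (3/4) t)" for i t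
    using sum_tubes_ge[where \<alpha>=\<beta> and x="v i (1/4) (1 - t)" and i=i] nn by (simp add: b_def compl tube1)
  have a0: "a (v i (3/4) t) = 0" for i t
    unfolding a_def using tube0 by (intro sum.neutral) auto
  have b0: "b (v i (1/4) t) = 0" for i t
    unfolding b_def compl using tube0[of _ i "1 - t"] by (intro sum.neutral) auto
  show "sublevel_threshold i g (L - \<alpha> i)" if i: "i \<noteq> k \<or> L = U"
  proof (rule sublevel_thresholdI[of "1/4"])
    show "g (\<chi> l. if l = i then t else 1/4) \<le> L - \<alpha> i" for t
    proof -
      have "f (v i (1/4) t) = L"
        using i f[of "v i (1/4) t"] by (auto simp: f_def v_def)
      then show ?thesis
        using a1[of i t] b0[of i t] by (simp add: g flip: v_def)
    qed
    have "L - \<alpha> i \<le> g z" if "z \<in> face_minus i" for z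
      using f(1)[of z] ab(2)[of z] face(1)[of z i] that by (auto simp: g face_minus_def)
    then show "(\<forall>z\<in>face_minus i. L - \<alpha> i \<le> g z) \<or> (\<forall>z\<in>face_plus i. L - \<alpha> i \<le> g z)"
      by blast
  qed auto
  show "superlevel_threshold i g (U + \<beta> i)" if i: "i \<noteq> k \<or> L = U"
  proof (rule superlevel_thresholdI[of "3/4"])
    show "U + \<beta> i \<le> g (\<chi> l. if l = i then t else 3/4)" for t
    proof -
      have "f (v i (3/4) t) = U"
        using i f[of "v i (3/4) t"] by (auto simp: f_def v_def)
      then show ?thesis
        using b1[of i t] a0[of i t] by (simp add: g flip: v_def)
    qed
    have "g z \<le> U + \<beta> i" if "z \<in> face_minus i" for z
      using f(2)[of z] ab(1)[of z] face(2)[of z i] that by (auto simp: g face_minus_def)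
    then show "(\<forall>z\<in>face_minus i. g z \<le> U + \<beta> i) \<or> (\<forall>z\<in>face_plus i. g z \<le> U + \<beta> i)"
      by blast
  qed auto
  show "sublevel_threshold k g U" if "L < U"
  proof (rule sublevel_thresholdI[of "1/4"])
    show "g (\<chi> l. if l = k then t else 1/4) \<le> U" for t
      using f(2)[of "v k (1/4) t"] ab(1)[of "v k (1/4) t"] b0[of k t] by (simp add: g flip: v_def)
    have "U \<le> g z" if "z \<in> face_plus k" for z
      using ab(2)[of z] face(1)[of z k] that zero[OF \<open>L < U\<close>] by (auto simp: g f_def face_plus_def)
    then show "(\<forall>z\<in>face_minus k. U \<le> g z) \<or> (\<forall>z\<in>face_plus k. U \<le> g z)"
      by blast
  qed auto
  show "superlevel_threshold k g L" if "L < U"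
  proof (rule superlevel_thresholdI[of "3/4"])
    show "L \<le> g (\<chi> l. if l = k then t else 3/4)" for t
      using f(1)[of "v k (3/4) t"] ab(2)[of "v k (3/4) t"] a0[of k t] by (simp add: g flip: v_def)
    have "g z \<le> L" if "z \<in> face_minus k" for z
      using ab(1)[of z] face(2)[of z k] that zero[OF \<open>L < U\<close>] by (auto simp: g f_def face_minus_def)
    then show "(\<forall>z\<in>face_minus k. g z \<le> L) \<or> (\<forall>z\<in>face_plus k. g z \<le> L)"
      by blast
  qed auto
qed

lemma thresholds_realizable:
  fixes m M :: "'n::finite \<Rightarrow> real"
  assumes card: "CARD('n) \<ge> 2" and le: "\<And>i j. i \<noteq> j \<Longrightarrow> m i \<le> M j"
    and planar: "\<And>i j. CARD('n) = 2 \<Longrightarrow> i \<noteq> j \<Longrightarrow> m i = M j"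
  obtains g :: "real ^ 'n \<Rightarrow> real" where "continuous_on unit_cube g"
    "\<And>i. sublevel_threshold i g (m i)" "\<And>i. superlevel_threshold i g (M i)"
proof -
  have other: "\<exists>l. l \<noteq> i" for i :: 'n
  proof (rule ccontr)
    assume "\<not> ?thesis"
    then have "(UNIV :: 'n set) = {i}" by auto
    then have "CARD('n) = 1" by (metis card_1_singleton_iff One_nat_def)
    then show False using card by simp
  qed
  have third: "\<exists>l. l \<noteq> i \<and> l \<noteq> j" if "CARD('n) \<noteq> 2" for i j :: 'n
  proof (rule ccontr)
    assume "\<not> ?thesis"
    then have "(UNIV :: 'n set) = {i, j}" by auto
    then have "CARD('n) \<le> 2" using card_insert_le_m1[of 2 "{j}" i] by simp
    then show False using card that by simp
  qed
  show thesis
  proof (cases "\<exists>k. M k < m k")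
    case True
    then obtain k where k: "M k < m k" by blast
    \<comment> \<open>The heights are forced by \<open>L - \<alpha> i = m i\<close> and
      \<open>U + \<beta> i = M i\<close> with \<open>L = M k\<close> and
      \<open>U = m k\<close>.\<close>
    define \<alpha> where "\<alpha> i = (if i = k then 0 else M k - m i)" for i
    define \<beta> where "\<beta> i = (if i = k then 0 else M i - m k)" for i
    have nn: "0 \<le> \<alpha> j" "0 \<le> \<beta> j" for j
      using le[of j k] le[of k j] by (auto simp: \<alpha>_def \<beta>_def)
    have avoid: "\<exists>l. l \<noteq> i \<and> l \<noteq> j" if "\<alpha> j \<noteq> 0 \<or> \<beta> j \<noteq> 0" for i j
    proof (rule third, rule)
      assume "CARD('n) = 2"
      then show False using that planar[of j k] planar[of k j] by (auto simp: \<alpha>_def \<beta>_def split: if_splits)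
    qed
    have z: "M k < m k \<Longrightarrow> \<alpha> k = 0 \<and> \<beta> k = 0"
      by (simp add: \<alpha>_def \<beta>_def)
    note thr = ramp_tubes_thresholds[where \<alpha> = \<alpha> and \<beta> = \<beta>, OF less_imp_le[OF k] nn z avoid]
    show thesis
    proof (rule that)
      show "sublevel_threshold i (ramp_tubes k (M k) (m k) \<alpha> \<beta>) (m i)" for i
        using thr(1)[of i] thr(3) k by (cases "i = k") (auto simp: \<alpha>_def)
      show "superlevel_threshold i (ramp_tubes k (M k) (m k) \<alpha> \<beta>) (M i)" for i
        using thr(2)[of i] thr(4) k by (cases "i = k") (auto simp: \<beta>_def)
    qed (rule continuous_ramp_tubes)
  next
    case False
    then have le': "m i \<le> M j" for i j
      using le[of i j] by (cases "i = j") (auto simp: not_less)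
    define c where "c = Max (range m)"
    have c: "m i \<le> c" "c \<le> M i" for i
      using le' by (auto simp: c_def)
    define \<alpha> where "\<alpha> i = c - m i" for i
    define \<beta> where "\<beta> i = M i - c" for i
    have nn: "0 \<le> \<alpha> j" "0 \<le> \<beta> j" for j
      using c by (auto simp: \<alpha>_def \<beta>_def)
    have avoid: "\<exists>l. l \<noteq> i \<and> l \<noteq> j" if "\<alpha> j \<noteq> 0 \<or> \<beta> j \<noteq> 0" for i j
    proof (rule third, rule)
      assume two: "CARD('n) = 2"
      obtain l where "l \<noteq> j" using other by blast
      then have "m j = M l" "m l = M j" using planar[OF two] by metis+
      then show False
        using that c[of j] c[of l] by (auto simp: \<alpha>_def \<beta>_def)
    qed
    have thr: "sublevel_threshold i (ramp_tubes k c c \<alpha> \<beta>) (c - \<alpha> i)"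
      "superlevel_threshold i (ramp_tubes k c c \<alpha> \<beta>) (c + \<beta> i)" for i k
      by (rule ramp_tubes_thresholds; use nn avoid in simp)+
    show thesis
      \<comment> \<open>With equal ends the ramp is constant, so any direction will do.\<close>
      by (rule that[of "ramp_tubes undefined c c \<alpha> \<beta>"])
        (use thr in \<open>auto simp: \<alpha>_def \<beta>_def continuous_ramp_tubes\<close>)
  qed
qed

section \<open>The five conditions in terms of thresholds\<close>

lemma Icc_eq_iff_real: "{a..b} = {c..d} \<longleftrightarrow> a = c \<and> b = d \<or> b < a \<and> d < (c::real)"
  by (auto simp: Icc_eq_Icc not_le)

lemma is_singleton_Icc: "is_singleton {a..b} \<longleftrightarrow> a = (b::real)"
  by (auto simp: is_singleton_def atLeastAtMost_singleton_iff)

lemma compact_interval_Icc: "compact_interval {a..b} \<longleftrightarrow> a < b"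
  by (auto simp: compact_interval_def Icc_eq_iff_real)

theorem theorem1:
  fixes A B :: "'n::finite \<Rightarrow> real set"
  assumes "CARD('n) \<ge> 2"
  shows "(\<exists>g :: real ^ 'n \<Rightarrow> real. continuous_on unit_cube g \<and>
            (\<forall>i. Conn i g = A i \<and> Sep i g = B i))
    \<longleftrightarrow>
      (\<forall>i. (compact_interval (A i) \<or> is_singleton (A i) \<or> A i = {}) \<and>
           (compact_interval (B i) \<or> is_singleton (B i) \<or> B i = {})) \<and>
      (\<forall>i. (A i = {} \<longrightarrow> compact_interval (B i)) \<and>
           (is_singleton (A i) \<longrightarrow> A i = B i) \<and>
           (compact_interval (A i) \<longrightarrow> B i = {})) \<and>
      (\<forall>i. B i \<subseteq> (\<Inter>j\<in>{j. j \<noteq> i}. A j)) \<and>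
      ((\<forall>i. A i \<noteq> {}) \<longrightarrow> (\<Inter>i. A i) \<noteq> {}) \<and>
      (CARD('n) = 2 \<longrightarrow> (\<forall>i j. i \<noteq> j \<longrightarrow> A i = B j))"
    (is "?realizable \<longleftrightarrow> ?intervals \<and> ?alternatives \<and> ?B_sub \<and> ?common \<and> ?planar")
proof
  assume ?realizable
  then obtain g :: "real ^ 'n \<Rightarrow> real" where g: "continuous_on unit_cube g"
    and AB: "\<And>i. A i = Conn i g" "\<And>i. B i = Sep i g"
    by metis
  have "\<exists>m. sublevel_threshold i g m" for i
    using sublevel_threshold_exists[OF g, of i] by blast
  then obtain m where m: "\<And>i. sublevel_threshold i g (m i)"
    by metis
  have "\<exists>M. superlevel_threshold i g M" for i
    using superlevel_threshold_exists[OF g, of i] by blast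
  then obtain M where M: "\<And>i. superlevel_threshold i g (M i)"
    by metis
  have A: "A i = {m i..M i}" and B: "B i = {M i..m i}" for i
    using AB Conn_eq_thresholds[OF g m M] Sep_eq_thresholds[OF g m M] by auto
  have le: "m i \<le> M j" if "i \<noteq> j" for i j
    using thresholds_le[OF g m M that] .
  have ?intervals
    by (auto simp: A B compact_interval_Icc is_singleton_Icc)
  moreover have ?alternatives
    by (auto simp: A B compact_interval_Icc is_singleton_Icc)
  moreover have "B i \<subseteq> A j" if "j \<noteq> i" for i j
    using le[of i j] le[of j i] that by (simp add: A B)
  then have ?B_sub
    by blast
  moreover have ?common
  proof
    assume "\<forall>i. A i \<noteq> {}"
    then have "m i \<le> M j" for i j
      using le[of i j] by (cases "i = j") (auto simp: A)
    then have "Max (range m) \<in> (\<Inter>i. A i)"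
      by (auto simp: A)
    then show "(\<Inter>i. A i) \<noteq> {}" by blast
  qed
  moreover have ?planar
  proof (intro impI allI)
    fix i j :: 'n assume "CARD('n) = 2" "i \<noteq> j"
    then have "m i = M j" "m j = M i"
      using le thresholds_ge_planar[OF _ g m M] by (metis order_antisym)+
    then show "A i = B j" by (simp add: A B)
  qed
  ultimately show "?intervals \<and> ?alternatives \<and> ?B_sub \<and> ?common \<and> ?planar"
    by (intro conjI)
next
  assume R: "?intervals \<and> ?alternatives \<and> ?B_sub \<and> ?common \<and> ?planar"
  note intervals = R[THEN conjunct1]
    and alternatives = R[THEN conjunct2, THEN conjunct1]
    and B_sub = R[THEN conjunct2, THEN conjunct2, THEN conjunct1]
    and common = R[THEN conjunct2, THEN conjunct2, THEN conjunct2, THEN conjunct1]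
    and planar = R[THEN conjunct2, THEN conjunct2, THEN conjunct2, THEN conjunct2]
  have "\<exists>m M. A i = {m..M} \<and> B i = {M..m}" for i
  proof -
    consider "compact_interval (A i)" | "is_singleton (A i)" | "A i = {}"
      using intervals by blast
    then show ?thesis
    proof cases
      case 1
      then obtain a b where "a < b" "A i = {a..b}" "B i = {}"
        using alternatives by (auto simp: compact_interval_def)
      then show ?thesis by (intro exI[of _ a] exI[of _ b]) auto
    next
      case 2
      then obtain a where "A i = {a}" "B i = {a}"
        using alternatives by (metis is_singletonE)
      then show ?thesis by (intro exI[of _ a]) auto
    next
      case 3
      then obtain a b where "a < b" "B i = {a..b}"
        using alternatives by (auto simp: compact_interval_def)
      then show ?thesis using 3 by (intro exI[of _ b] exI[of _ a]) auto
    qed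
  qed
  then obtain m M where A: "\<And>i. A i = {m i..M i}" and B: "\<And>i. B i = {M i..m i}"
    by metis
  have sub: "p \<in> A j" if "p \<in> B i" "i \<noteq> j" for p i j
    using B_sub that by blast
  have le: "m i \<le> M j" if "i \<noteq> j" for i j
  proof (cases "\<forall>l. A l \<noteq> {}")
    case True
    then obtain p where "p \<in> (\<Inter>i. A i)"
      using common by blast
    then have "p \<in> A i" "p \<in> A j" by blast+
    then show ?thesis by (simp add: A)
  next
    case False
    then obtain l where l: "M l < m l"
      unfolding A by (metis atLeastatMost_empty_iff not_le)
    \<comment> \<open>Both ends of the nonempty \<open>B l\<close> lie in every other
      \<open>A j'\<close>; this bounds all other thresholds on the correct sides of
      \<open>M l\<close> and \<open>m l\<close>.\<close>
    then have *: "M l \<in> A j'" "m l \<in> A j'" if "j' \<noteq> l" for j'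
      using sub[of _ l j'] that by (auto simp: B)
    show ?thesis
      using *[of i] *[of j] that by (cases "i = l"; cases "j = l") (auto simp: A)
  qed
  have planar_eq: "m i = M j" if "CARD('n) = 2" "i \<noteq> j" for i j
  proof -
    \<comment> \<open>If \<open>A i\<close> and \<open>B j\<close> are empty, the first equation
      does not reveal their ends; but then \<open>B i\<close> is nonempty and the second one
      does.\<close>
    have "A i = B j" "A j = B i"
      using planar that by auto
    then show ?thesis
      using le[OF that(2)] le[of j i] that(2) by (auto simp: A B Icc_eq_iff_real)
  qed
  obtain g :: "real ^ 'n \<Rightarrow> real" where g: "continuous_on unit_cube g"
    "\<And>i. sublevel_threshold i g (m i)" "\<And>i. superlevel_threshold i g (M i)"
    using thresholds_realizable[where m = m and M = M, OF assms le planar_eq] by blast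
  then have "Conn i g = A i" "Sep i g = B i" for i
    using Conn_eq_thresholds[OF g] Sep_eq_thresholds[OF g] by (auto simp: A B)
  then show ?realizable
    using g(1) by blast
qed

end
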